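(* Let $\mathbf u$ be an infinite word over a finite alphabet whose language is closed under reversal. Then $D(\mathbf u)<+\infty$ if and only if $\sum_{n=0}^{+\infty}T_{\mathbf u}(n)<+\infty$.
   Context: For a finite word $w=w_0\cdots w_{n-1}$ its reversal is $\overline{w}=w_{n-1}\cdots w_0$; $w$ is a palindrome if $w=\overline{w}$ (the empty word is a palindrome). The language $\mathcal L(\mathbf u)$ is the set of all finite factors of $\mathbf u$, and $\mathcal L_n(\mathbf u)$ those of length $n$; the language is closed under reversal if $w\in\mathcal L(\mathbf u)$ implies $\overline w\in\mathcal L(\mathbf u)$. The factor complexity is $\mathcal C_{\mathbf u}(n)=\#\mathcal L_n(\mathbf u)$ and the palindromic complexity $\mathcal P_{\mathbf u}(n)$ is the number of palindromes in $\mathcal L_n(\mathbf u)$. Define $T_{\mathbf u}(n)=\mathcal C_{\mathbf u}(n+1)-\mathcal C_{\mathbf u}(n)+2-\mathcal P_{\mathbf u}(n+1)-\mathcal P_{\mathbf u}(n)$ (it is known that $T_{\mathbf u}(n)\ge 0$ for such words). The defect of a finite word $w$ is $D(w)=|w|+1-(\text{number of distinct palindromic factors of } w, \text{ including the empty word})$. The defect of an infinite word is $D(\mathbf u)=\sup\{D(w): w \text{ a prefix of } \mathbf u\}$ (possibly $+\infty$). *)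

theory Defs
  imports Complex_Main "HOL-Library.Sublist"
begin

definition factor_at :: "(nat \<Rightarrow> 'a) \<Rightarrow> nat \<Rightarrow> nat \<Rightarrow> 'a list" where
  "factor_at u i n = map u [i..<i+n]"

definition lang :: "(nat \<Rightarrow> 'a) \<Rightarrow> 'a list set" where
  "lang u = {factor_at u i n | i n. True}"

definition lang_n :: "(nat \<Rightarrow> 'a) \<Rightarrow> nat \<Rightarrow> 'a list set" where
  "lang_n u n = {w \<in> lang u. length w = n}"

definition closed_under_reversal :: "(nat \<Rightarrow> 'a) \<Rightarrow> bool" where
  "closed_under_reversal u \<longleftrightarrow> (\<forall>w \<in> lang u. rev w \<in> lang u)"

definition fcompl :: "(nat \<Rightarrow> 'a) \<Rightarrow> nat \<Rightarrow> nat" where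
  "fcompl u n = card (lang_n u n)"

definition pcompl :: "(nat \<Rightarrow> 'a) \<Rightarrow> nat \<Rightarrow> nat" where
  "pcompl u n = card {w \<in> lang_n u n. rev w = w}"

definition T_fun :: "(nat \<Rightarrow> 'a) \<Rightarrow> nat \<Rightarrow> int" where
  "T_fun u n = int (fcompl u (n+1)) - int (fcompl u n) + 2
               - int (pcompl u (n+1)) - int (pcompl u n)"

text \<open>Defect of a finite word (palindromic factors include the empty word).\<close>
definition defect :: "'a list \<Rightarrow> int" where
  "defect w = int (length w) + 1 - int (card {v. sublist v w \<and> rev v = v})"

definition prefix_of :: "(nat \<Rightarrow> 'a) \<Rightarrow> nat \<Rightarrow> 'a list" where
  "prefix_of u n = map u [0..<n]"

definition finite_defect :: "(nat \<Rightarrow> 'a) \<Rightarrow> bool" where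
  "finite_defect u \<longleftrightarrow> (\<exists>B::int. \<forall>n. defect (prefix_of u n) \<le> B)"

end

theory Submission
  imports Defs
begin

text \<open>
  Identify each factor with its reversal. The windows of length \<open>n\<close> of \<open>u\<close> then form a walk
  through a connected graph whose vertices are the reversal classes of \<open>\<L>\<^sub>n\<close> and whose edges are
  the reversal classes of \<open>\<L>\<^sub>n\<^sub>+\<^sub>1\<close>, palindromic edges being loops. Counting classes shows that
  \<open>T n = 0\<close> holds iff the non-palindromic edges form a tree, i.e. iff every such edge
  is the one through which the walk enters some vertex for the first time. In a tree, a walk that returns
  to its starting vertex for the first time does so through its first edge; applied
  to the lengths \<open>n, n + 1, \<dots>\<close> this shows that \<open>T\<close> vanishes from \<open>N\<close> on iff, for all
  \<open>n \<ge> N\<close>, the factor spanned by two consecutive occurrences of a reversal class of length \<open>n\<close>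
  is a palindrome. On the other side, the defect of the prefixes grows
  exactly at those positions where no new palindrome ends, and all but finitely many positions
  contribute a new palindrome iff the same return property holds for some \<open>N\<close>.
\<close>

section \<open>Walks covering a tree\<close>

text \<open>Indexed by the step that reaches a new vertex, so that the same index names the edge
  used.\<close>

definition discovery :: "(nat \<Rightarrow> 'v) \<Rightarrow> nat set" where
  "discovery c = {j. c (Suc j) \<notin> c ` {..j}}"

lemma discoveryD: "j \<in> discovery c \<Longrightarrow> k \<le> j \<Longrightarrow> c k \<noteq> c (Suc j)"
  by (metis (mono_tags, lifting) atMost_iff discovery_def image_eqI mem_Collect_eq)

locale walk =
  fixes c :: "nat \<Rightarrow> 'v" and e :: "nat \<Rightarrow> 'e"
  assumes edge_ends: "e i = e j \<Longrightarrow> {c i, c (Suc i)} = {c j, c (Suc j)}"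
begin

text \<open>A repeated label would make the new end of the later edge an end of the earlier one,
  hence already visited.\<close>

lemma inj_on_edge_discovery: "inj_on e (discovery c)"
proof (rule linorder_inj_onI)
  fix i j assume ij: "i < j" "i \<in> discovery c" "j \<in> discovery c"
  show "e i \<noteq> e j"
  proof
    assume "e i = e j"
    then have "c (Suc j) \<in> {c i, c (Suc i)}" using edge_ends by blast
    with ij discoveryD[of j c i] discoveryD[of j c "Suc i"] show False by auto
  qed
qed auto

lemma inj_on_vertex_discovery: "inj_on (c \<circ> Suc) (discovery c)"
proof (rule linorder_inj_onI)
  fix i j assume "i < j" "i \<in> discovery c" "j \<in> discovery c"
  then show "(c \<circ> Suc) i \<noteq> (c \<circ> Suc) j"
    using discoveryD[of j c "Suc i"] by simp
qed auto

lemma vertex_image_discovery: "(c \<circ> Suc) ` discovery c = range c - {c 0}"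
proof
  show "(c \<circ> Suc) ` discovery c \<subseteq> range c - {c 0}"
  proof (rule image_subsetI)
    fix j assume "j \<in> discovery c"
    from discoveryD[OF this, of 0] show "(c \<circ> Suc) j \<in> range c - {c 0}" by auto
  qed
  show "range c - {c 0} \<subseteq> (c \<circ> Suc) ` discovery c"
  proof
    fix x assume x: "x \<in> range c - {c 0}"
    define k where "k = (LEAST k. c k = x)"
    have "\<exists>k. c k = x" using x by blast
    then have ck: "c k = x" unfolding k_def by (rule LeastI_ex)
    with x obtain j where j: "k = Suc j" by (cases k) auto
    have "c i \<noteq> x" if "i \<le> j" for i
      using not_less_Least[of i "\<lambda>k. c k = x"] that j unfolding k_def by auto
    then have "x \<notin> c ` {..j}" by auto
    then have "j \<in> discovery c" using ck j by (simp add: discovery_def)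
    then show "x \<in> (c \<circ> Suc) ` discovery c" by (rule rev_image_eqI) (simp add: ck[unfolded j])
  qed
qed

lemma card_edge_discovery:
  assumes "finite (range c)"
  shows "card (e ` discovery c) = card (range c) - 1"
proof -
  have "card (e ` discovery c) = card ((c \<circ> Suc) ` discovery c)"
    using inj_on_edge_discovery inj_on_vertex_discovery by (simp only: card_image)
  then show ?thesis using assms by (simp only: vertex_image_discovery) auto
qed

text \<open>The discovery edges form a spanning tree and come from \<open>A\<close>, since steps
  outside \<open>A\<close> discover nothing; for finite sets equality is then a matter of
  cardinality.\<close>

lemma discovery_edges_eq_iff_card:
  assumes fin: "finite (range c)" "finite (e ` A)"
    and loop: "\<And>j. j \<notin> A \<Longrightarrow> c (Suc j) = c j"
  shows "e ` A = e ` discovery c \<longleftrightarrow> card (e ` A) = card (range c) - 1"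
proof -
  have "discovery c \<subseteq> A" using loop discoveryD by fastforce
  then have sub: "e ` discovery c \<subseteq> e ` A" by blast
  show ?thesis
    using card_edge_discovery[OF fin(1)] card_subset_eq[OF fin(2) sub] by metis
qed

text \<open>
  Deleting the edge \<open>e i\<close> separates the vertices into the descendants \<open>S\<close> of its lower end and the
  rest, so the walk can only come back to \<open>c i\<close> by crossing \<open>e i\<close> again.
\<close>

lemma first_return_same_edge:
  assumes loop: "\<And>j. j \<notin> A \<Longrightarrow> c (Suc j) = c j"
    and tree: "e ` A = e ` discovery c"
    and ij: "Suc i < j" "c i = c j" and new: "\<And>k. i < k \<Longrightarrow> k < j \<Longrightarrow> c k \<noteq> c i"
  shows "e (j - 1) = e i"
proof -
  have iA: "i \<in> A" using loop[of i] new[of "Suc i"] ij(1) by auto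
  then obtain d where d: "d \<in> discovery c" "e i = e d" using tree by blast
  \<comment> \<open>\<open>R\<close> sends each discovered vertex to its parent, from which it was
    discovered; \<open>t\<close> is the time of first visit, which never increases along
    \<open>R\<close>.\<close>
  define R where "R = {(c (Suc k), c k) | k. k \<in> discovery c}"
  define S where "S = {x. (x, c (Suc d)) \<in> R\<^sup>*}"
  define t where "t x = (LEAST k. c k = x)" for x
  have t_le: "t (c k) \<le> k" for k unfolding t_def by (rule Least_le) simp
  have t_disc: "t (c (Suc k)) = Suc k" if "k \<in> discovery c" for k
    unfolding t_def
  proof (rule Least_equality)
    fix y assume "c y = c (Suc k)"
    then show "Suc k \<le> y" using discoveryD[OF that, of y] not_less_eq_eq by blast
  qed simp
  have dec: "(x, y) \<in> R\<^sup>* \<Longrightarrow> t y \<le> t x" for x y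
  proof (induction rule: rtrancl_induct)
    case (step y z)
    then obtain k where "k \<in> discovery c" "y = c (Suc k)" "z = c k" unfolding R_def by auto
    then show ?case using step t_le[of k] t_disc[of k] by auto
  qed simp
  have d_in: "c (Suc d) \<in> S" unfolding S_def by simp
  have d_out: "c d \<notin> S"
    using dec[of "c d" "c (Suc d)"] t_disc[OF d(1)] t_le[of d] unfolding S_def by auto
  have inj: "k = k'" if "c (Suc k) = c (Suc k')" "k \<in> discovery c" "k' \<in> discovery c" for k k'
    using inj_onD[OF inj_on_vertex_discovery, of k k'] that by simp
  \<comment> \<open>A vertex is discovered only once, so its parent is unique and every tree edge
    other than that of \<open>d\<close> has both ends in \<open>S\<close> or both outside.\<close>
  have disc_iff: "c (Suc k) \<in> S \<longleftrightarrow> c k \<in> S" if k: "k \<in> discovery c" "k \<noteq> d" for k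
  proof
    assume "c (Suc k) \<in> S"
    then have "(c (Suc k), c (Suc d)) \<in> R\<^sup>*" unfolding S_def by simp
    then show "c k \<in> S"
    proof (cases rule: converse_rtranclE)
      case base
      then show ?thesis using inj k d by blast
    next
      case (step y)
      then obtain k' where k': "k' \<in> discovery c" "c (Suc k) = c (Suc k')" "y = c k'"
        unfolding R_def by auto
      then have "k' = k" using inj k by blast
      then show ?thesis using step(2) k'(3) unfolding S_def by simp
    qed
  next
    assume "c k \<in> S"
    moreover have "(c (Suc k), c k) \<in> R" unfolding R_def using k by blast
    ultimately show "c (Suc k) \<in> S" unfolding S_def
      by (simp add: converse_rtrancl_into_rtrancl)
  qed
  have no_cross: "c (Suc l) \<in> S \<longleftrightarrow> c l \<in> S" if "e l \<noteq> e i" for l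
  proof (cases "l \<in> A")
    case True
    then obtain k where k: "k \<in> discovery c" "e l = e k" using tree by blast
    then have "k \<noteq> d" using that d by auto
    then show ?thesis using disc_iff[OF k(1)] edge_ends[OF k(2)]
      by (auto simp: doubleton_eq_iff)
  qed (simp add: loop)
  have cross: "c (Suc i) \<in> S \<longleftrightarrow> c i \<notin> S"
    using edge_ends[OF d(2)] d_in d_out by (auto simp: doubleton_eq_iff)
  have "\<exists>l. i < l \<and> l < j \<and> e l = e i"
  proof (rule ccontr)
    assume none: "\<not> ?thesis"
    have "c k \<in> S \<longleftrightarrow> c (Suc i) \<in> S" if "Suc i \<le> k" "k \<le> j" for k
      using that
    proof (induction k rule: dec_induct)
      case (step k)
      then show ?case using no_cross[of k] none by auto
    qed simp
    from this[of j] show False using cross ij by auto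
  qed
  then obtain l where l: "i < l" "l < j" "e l = e i" by blast
  \<comment> \<open>The second crossing has the same ends as \<open>e i\<close>; as
    \<open>c i\<close> is not visited strictly in between, the walk reaches it at
    \<open>j\<close>.\<close>
  have "c i \<in> {c l, c (Suc l)}" using edge_ends[OF l(3)] by blast
  then have "Suc l = j" using new[of l] new[of "Suc l"] l by force
  then show ?thesis using l by auto
qed

lemma loop_not_in_edges:
  assumes loop: "\<And>j. j \<notin> A \<Longrightarrow> c (Suc j) = c j"
    and tree: "e ` A = e ` discovery c" and "c (Suc i) = c i"
  shows "i \<notin> A"
proof
  assume "i \<in> A"
  then obtain d where d: "d \<in> discovery c" "e i = e d" using tree by blast
  then have "c d = c (Suc d)" using edge_ends[OF d(2)] assms(3) by (auto simp: doubleton_eq_iff)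
  with discoveryD[OF d(1), of d] show False by simp
qed

end

section \<open>Reversal classes of factors\<close>

lemma length_factor_at [simp]: "length (factor_at u i n) = n"
  by (simp add: factor_at_def)

lemma nth_factor_at [simp]: "k < n \<Longrightarrow> factor_at u i n ! k = u (i + k)"
  by (simp add: factor_at_def)

lemma factor_at_eq_sub:
  assumes "factor_at u a l = factor_at v b l" "x + n \<le> l"
  shows "factor_at u (a + x) n = factor_at v (b + x) n"
proof (rule nth_equalityI)
  fix k assume "k < length (factor_at u (a + x) n)"
  then show "factor_at u (a + x) n ! k = factor_at v (b + x) n ! k"
    using arg_cong[OF assms(1), of "\<lambda>w. w ! (x + k)"] assms(2) by (simp add: add.assoc)
qed simp

text \<open>Reversal carries offset \<open>x\<close> to \<open>l - n - x\<close>; for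
  \<open>v = u\<close> and \<open>b = a\<close> this locates mirror images inside a
  palindrome.\<close>

lemma factor_at_rev_sub:
  assumes "factor_at u a l = rev (factor_at v b l)" "x + n \<le> l"
  shows "factor_at u (a + x) n = rev (factor_at v (b + (l - n - x)) n)"
proof (rule nth_equalityI)
  fix k assume k: "k < length (factor_at u (a + x) n)"
  then have "l - Suc (x + k) = l - n - x + (n - Suc k)" using assms(2) by simp
  then show "factor_at u (a + x) n ! k = rev (factor_at v (b + (l - n - x)) n) ! k"
    using arg_cong[OF assms(1), of "\<lambda>w. w ! (x + k)"] assms(2) k
    by (simp add: add.assoc add.commute[of k] rev_nth)
qed simp

definition rev_class :: "'a list \<Rightarrow> 'a list set" where
  "rev_class w = {w, rev w}"

lemma rev_class_eq_iff: "rev_class v = rev_class w \<longleftrightarrow> v = w \<or> v = rev w"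
  by (auto simp: rev_class_def doubleton_eq_iff)

lemma rev_class_rev [simp]: "rev_class (rev w) = rev_class w"
  by (simp add: rev_class_eq_iff)

lemma rev_class_eq_palindrome: "rev_class v = rev_class w \<Longrightarrow> rev v = v \<longleftrightarrow> rev w = w"
  by (auto simp: rev_class_eq_iff)

definition factor_class :: "(nat \<Rightarrow> 'a) \<Rightarrow> nat \<Rightarrow> nat \<Rightarrow> 'a list set" where
  "factor_class u n i = rev_class (factor_at u i n)"

lemma factor_class_cases:
  assumes "factor_class u n i = factor_class u n j"
  obtains "factor_at u i n = factor_at u j n" | "factor_at u i n = rev (factor_at u j n)"
  using assms by (auto simp: factor_class_def rev_class_eq_iff)

lemma factor_class_eq_palindrome:
  "factor_class u n i = factor_class u n j \<Longrightarrow>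
    rev (factor_at u i n) = factor_at u i n \<longleftrightarrow> rev (factor_at u j n) = factor_at u j n"
  unfolding factor_class_def by (rule rev_class_eq_palindrome)

lemma factor_class_eq_sub:
  assumes "factor_at u a l = factor_at u b l" "x + n \<le> l"
  shows "factor_class u n (a + x) = factor_class u n (b + x)"
  using factor_at_eq_sub[OF assms] by (simp add: factor_class_def)

lemma factor_class_rev_sub:
  assumes "factor_at u a l = rev (factor_at u b l)" "x + n \<le> l"
  shows "factor_class u n (a + x) = factor_class u n (b + (l - n - x))"
  using factor_at_rev_sub[OF assms] by (simp add: factor_class_def)

text \<open>The ends of an edge are the classes of the prefix and suffix of length \<open>n\<close>;
  reversing the factor swaps them.\<close>

lemma walk_factor_class: "walk (factor_class u n) (factor_class u (Suc n))"
proof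
  fix i j assume "factor_class u (Suc n) i = factor_class u (Suc n) j"
  then show "{factor_class u n i, factor_class u n (Suc i)} =
    {factor_class u n j, factor_class u n (Suc j)}"
  proof (cases rule: factor_class_cases)
    case 1
    from factor_class_eq_sub[OF this, of 0 n] factor_class_eq_sub[OF this, of 1 n]
    show ?thesis by simp
  next
    case 2
    from factor_class_rev_sub[OF this, of 0 n] factor_class_rev_sub[OF this, of 1 n]
    show ?thesis by auto
  qed
qed

definition nonpal_pos :: "(nat \<Rightarrow> 'a) \<Rightarrow> nat \<Rightarrow> nat set" where
  "nonpal_pos u n = {i. rev (factor_at u i n) \<noteq> factor_at u i n}"

lemma palindrome_loop:
  assumes "i \<notin> nonpal_pos u (Suc n)"
  shows "factor_class u n (Suc i) = factor_class u n i"
proof -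
  have "factor_at u i (Suc n) = rev (factor_at u i (Suc n))"
    using assms by (simp add: nonpal_pos_def)
  from factor_class_rev_sub[OF this, of 1 n] show ?thesis by simp
qed

section \<open>Counting reversal classes\<close>

lemma lang_n_eq_range: "lang_n u n = range (\<lambda>i. factor_at u i n)"
  by (auto simp: lang_n_def lang_def)

lemma finite_lang_n: "finite (lang_n (u :: nat \<Rightarrow> 'a::finite) n)"
  by (rule finite_subset[OF _ finite_lists_length_eq[of UNIV n]]) (auto simp: lang_n_def)

lemma range_factor_class: "range (factor_class u n) = rev_class ` lang_n u n"
  by (auto simp: lang_n_eq_range factor_class_def)

text \<open>Each class receives weight 2: two words of weight 1, or one palindrome counted in both
  terms.\<close>

lemma card_rev_closed:
  assumes fin: "finite A" and cl: "\<And>w. w \<in> A \<Longrightarrow> rev w \<in> A"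
  shows "card A + card {w \<in> A. rev w = w} = 2 * card (rev_class ` A)"
proof -
  define h :: "'a list \<Rightarrow> nat" where "h w = 1 + (if rev w = w then 1 else 0)" for w
  have "sum h {v \<in> A. rev_class v = K} = 2" if K: "K \<in> rev_class ` A" for K
  proof -
    obtain w where w: "w \<in> A" "K = rev_class w" using K by blast
    have "{v \<in> A. rev_class v = K} = {w, rev w}"
      using w cl by (auto simp: rev_class_eq_iff)
    then show ?thesis by (cases "rev w = w") (auto simp: h_def)
  qed
  then have "sum h A = 2 * card (rev_class ` A)"
    using sum.image_gen[OF fin, of h rev_class] by simp
  moreover have "sum h A = card A + card {w \<in> A. rev w = w}"
    unfolding h_def sum.distrib using fin by (simp add: sum.If_cases Int_def)
  ultimately show ?thesis by simp
qed

text \<open>Counting classes at both lengths shows that \<open>T_fun u n\<close> is twice the excess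
  of the number of non-palindromic edges over that of the edges of a spanning tree.\<close>

lemma T_fun_eq_0_iff:
  fixes u :: "nat \<Rightarrow> 'a::finite"
  assumes "closed_under_reversal u"
  shows "T_fun u n = 0 \<longleftrightarrow>
    factor_class u (Suc n) ` nonpal_pos u (Suc n) =
    factor_class u (Suc n) ` discovery (factor_class u n)"
proof -
  let ?V = "range (factor_class u n)"
  let ?E = "factor_class u (Suc n) ` nonpal_pos u (Suc n)"
  let ?L = "lang_n u (Suc n)"
  let ?B = "{w \<in> ?L. rev w \<noteq> w}"
  have cl: "rev w \<in> lang_n u m" if "w \<in> lang_n u m" for w m
    using assms that by (auto simp: closed_under_reversal_def lang_n_def)
  have E: "?E = rev_class ` ?B"
    by (auto simp: lang_n_eq_range factor_class_def nonpal_pos_def)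
  have finE: "finite ?E" unfolding E using finite_lang_n[of u "Suc n"] by simp
  have finV: "finite ?V" unfolding range_factor_class by (intro finite_imageI finite_lang_n)
  have V: "fcompl u n + pcompl u n = 2 * card ?V"
    unfolding range_factor_class fcompl_def pcompl_def
    by (rule card_rev_closed) (auto intro: finite_lang_n cl)
  have "card ?B + card {w \<in> ?B. rev w = w} = 2 * card ?E"
    unfolding E
    by (rule card_rev_closed) (auto intro: cl finite_subset[OF _ finite_lang_n[of u "Suc n"]])
  then have B: "card ?B = 2 * card ?E" by simp
  have "?L = ?B \<union> {w \<in> ?L. rev w = w}" by auto
  then have "card ?L = card ?B + card {w \<in> ?L. rev w = w}"
    using finite_lang_n[of u "Suc n"] card_Un_disjoint[of ?B "{w \<in> ?L. rev w = w}"] by fastforce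
  then have "int (fcompl u (Suc n)) = 2 * card ?E + pcompl u (Suc n)"
    unfolding fcompl_def pcompl_def B by simp
  \<comment> \<open>Makes the truncated \<open>card ?V - 1\<close> agree with the integer
    difference.\<close>
  moreover have "card ?V > 0" using finV by (simp add: card_gt_0_iff)
  ultimately have "T_fun u n = 0 \<longleftrightarrow> card ?E = card ?V - 1"
    using V unfolding T_fun_def by auto
  also have "\<dots> \<longleftrightarrow> ?E = factor_class u (Suc n) ` discovery (factor_class u n)"
    using walk.discovery_edges_eq_iff_card[OF walk_factor_class finV finE palindrome_loop] by blast
  finally show ?thesis .
qed

section \<open>The return property\<close>

definition first_return :: "(nat \<Rightarrow> 'v) \<Rightarrow> nat \<Rightarrow> nat \<Rightarrow> bool" where
  "first_return c i j \<longleftrightarrow> i < j \<and> c i = c j \<and> (\<forall>k. i < k \<longrightarrow> k < j \<longrightarrow> c k \<noteq> c i)"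

text \<open>The start moves to the last visit before \<open>j\<close>, while the end
  \<open>j\<close> stays fixed.\<close>

lemma first_return_exists:
  assumes "c i = c j" "i < j"
  obtains i' where "i \<le> i'" "first_return c i' j"
proof -
  let ?P = "\<lambda>k. k < j \<and> c k = c j"
  have P: "?P (GREATEST k. ?P k)"
    by (rule GreatestI_nat[of ?P i j]) (use assms in auto)
  have le: "k \<le> (GREATEST k. ?P k)" if "?P k" for k
    by (rule Greatest_le_nat[of ?P k j]) (use that in auto)
  show ?thesis
    by (rule that[of "GREATEST k. ?P k"]) (use P le assms in \<open>auto simp: first_return_def not_le[symmetric]\<close>)
qed

text \<open>The word runs from the beginning of the window at \<open>i\<close> to the end of the
  window at \<open>j\<close>: a complete return of the class.\<close>

definition palindromic_returns :: "(nat \<Rightarrow> 'a) \<Rightarrow> nat \<Rightarrow> bool" where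
  "palindromic_returns u n \<longleftrightarrow> (\<forall>i j. first_return (factor_class u n) i j \<longrightarrow>
     rev (factor_at u i (j - i + n)) = factor_at u i (j - i + n))"

text \<open>Induction on the gap: the last edge equals the first, so the same word is a return for
  length \<open>n + 1\<close> with the gap reduced by 1. At gap 1 the word is a single edge that is
  a loop, hence a palindrome.\<close>

lemma palindromic_returns_if_T_fun_eq_0:
  fixes u :: "nat \<Rightarrow> 'a::finite"
  assumes cl: "closed_under_reversal u" and T: "\<And>n. n \<ge> N \<Longrightarrow> T_fun u n = 0" and "n \<ge> N"
  shows "palindromic_returns u n"
proof -
  have "rev (factor_at u i (j - i + n)) = factor_at u i (j - i + n)"
    if "n \<ge> N" "first_return (factor_class u n) i j" for i j n
    using that
  proof (induction "j - i" arbitrary: j n)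
    case (Suc d)
    interpret walk "factor_class u n" "factor_class u (Suc n)" by (rule walk_factor_class)
    note tree = T_fun_eq_0_iff[OF cl, THEN iffD1, OF T[OF Suc.prems(1)]]
    have fr: "i < j" "factor_class u n i = factor_class u n j"
      "\<And>k. i < k \<Longrightarrow> k < j \<Longrightarrow> factor_class u n k \<noteq> factor_class u n i"
      using Suc.prems(2) by (auto simp: first_return_def)
    show ?case
    proof (cases "j = Suc i")
      case True
      then show ?thesis
        using loop_not_in_edges[OF palindrome_loop tree, of i] fr(2) by (auto simp: nonpal_pos_def)
    next
      case False
      then have j: "Suc i < j" using fr(1) by simp
      have same: "factor_class u (Suc n) (j - 1) = factor_class u (Suc n) i"
        by (rule first_return_same_edge[OF palindrome_loop tree j fr(2,3)])
      have "factor_class u (Suc n) k \<noteq> factor_class u (Suc n) i" if "i < k" "k < j - 1" for k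
      proof
        assume "factor_class u (Suc n) k = factor_class u (Suc n) i"
        from edge_ends[OF this] have "factor_class u n i \<in> {factor_class u n k, factor_class u n (Suc k)}"
          by blast
        moreover have "k < j" "Suc k < j" using that by auto
        ultimately show False using fr(3)[of k] fr(3)[of "Suc k"] that(1) by auto
      qed
      then have "first_return (factor_class u (Suc n)) i (j - 1)"
        using j same by (auto simp: first_return_def)
      moreover have "d = j - 1 - i" "j - 1 - i + Suc n = j - i + n" using Suc.hyps(2) j by auto
      ultimately show ?thesis using Suc.hyps(1)[of "j - 1" "Suc n"] Suc.prems(1) by (metis le_SucI)
    qed
  qed (simp add: first_return_def)
  with \<open>n \<ge> N\<close> show ?thesis unfolding palindromic_returns_def by blast
qed

text \<open>Take a non-palindromic edge at its first occurrence \<open>j\<close>. Had its end been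
  visited before, the palindromic return ending at \<open>Suc j\<close> would begin with the
  mirrored edge, hence at \<open>j\<close> itself, making the edge a palindrome.\<close>

lemma T_fun_eq_0_if_palindromic_returns:
  fixes u :: "nat \<Rightarrow> 'a::finite"
  assumes cl: "closed_under_reversal u" and ret: "palindromic_returns u n"
  shows "T_fun u n = 0"
  unfolding T_fun_eq_0_iff[OF cl]
proof
  let ?c = "factor_class u n" and ?e = "factor_class u (Suc n)"
  show "?e ` discovery ?c \<subseteq> ?e ` nonpal_pos u (Suc n)"
    using palindrome_loop[of _ u n] discoveryD[of _ ?c] by fastforce
  show "?e ` nonpal_pos u (Suc n) \<subseteq> ?e ` discovery ?c"
  proof (rule image_subsetI)
    fix j0 assume j0: "j0 \<in> nonpal_pos u (Suc n)"
    define j where "j = (LEAST j. ?e j = ?e j0)"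
    have j: "?e j = ?e j0" unfolding j_def by (rule LeastI) simp
    have j_le: "j \<le> k" if "?e k = ?e j" for k
      unfolding j_def by (rule Least_le) (use that j in simp)
    have nonpal: "rev (factor_at u j (Suc n)) \<noteq> factor_at u j (Suc n)"
      using j0 factor_class_eq_palindrome[OF j] by (simp add: nonpal_pos_def)
    have "?c (Suc j) \<noteq> ?c k" if "k \<le> j" for k
    proof
      assume "?c (Suc j) = ?c k"
      then have eq: "?c k = ?c (Suc j)" by simp
      have "k < Suc j" using that by simp
      from first_return_exists[OF eq this]
      obtain i where i: "first_return ?c i (Suc j)" by blast
      then have ij: "i \<le> j" by (simp add: first_return_def)
      have "factor_at u i (Suc j - i + n) = rev (factor_at u i (Suc j - i + n))"
        using ret i by (simp add: palindromic_returns_def)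
      note pal = factor_class_rev_sub[OF this, of 0 "Suc n"] this
      from pal(1) ij have "?e i = ?e j" by simp
      from j_le[OF this] ij have "i = j" by simp
      with pal(2) nonpal show False by simp
    qed
    then have "j \<in> discovery ?c" by (auto simp: discovery_def)
    with j show "?e j0 \<in> ?e ` discovery ?c" by (metis image_eqI)
  qed
qed

section \<open>Defect\<close>

definition prefix_pals :: "(nat \<Rightarrow> 'a) \<Rightarrow> nat \<Rightarrow> 'a list set" where
  "prefix_pals u n = {factor_at u i m | i m. i + m \<le> n \<and> rev (factor_at u i m) = factor_at u i m}"

lemma sublist_prefix_of_iff:
  "sublist v (prefix_of u n) \<longleftrightarrow> (\<exists>i m. i + m \<le> n \<and> v = factor_at u i m)"
proof
  assume "sublist v (prefix_of u n)"
  then obtain p s where ps: "prefix_of u n = p @ v @ s" by (auto simp: sublist_def)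
  have len: "n = length p + (length v + length s)"
    using arg_cong[OF ps, of length] by (simp add: prefix_of_def)
  have "v = factor_at u (length p) (length v)"
  proof (rule nth_equalityI)
    fix k assume k: "k < length v"
    have "prefix_of u n ! (length p + k) = v ! k" using k by (simp add: ps nth_append)
    then show "v ! k = factor_at u (length p) (length v) ! k"
      using k len by (simp add: prefix_of_def)
  qed simp
  with len show "\<exists>i m. i + m \<le> n \<and> v = factor_at u i m" by (metis add_leE le_add1 add.assoc)
next
  assume "\<exists>i m. i + m \<le> n \<and> v = factor_at u i m"
  then obtain i m where im: "i + m \<le> n" "v = factor_at u i m" by blast
  then have "[0..<n] = [0..<i] @ [i..<i + m] @ [i + m..<n]"
    using upt_add_eq_append[of 0 i m] upt_add_eq_append[of 0 "i + m" "n - (i + m)"] by simp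
  then have "prefix_of u n = map u [0..<i] @ v @ map u [i + m..<n]"
    unfolding prefix_of_def im(2) factor_at_def by (metis map_append)
  then show "sublist v (prefix_of u n)" by (auto simp: sublist_def)
qed

lemma defect_prefix_of: "defect (prefix_of u n) = int n + 1 - int (card (prefix_pals u n))"
proof -
  have "{v. sublist v (prefix_of u n) \<and> rev v = v} = prefix_pals u n"
    by (auto simp: sublist_prefix_of_iff prefix_pals_def)
  then show ?thesis by (simp add: defect_def prefix_of_def)
qed

lemma finite_prefix_pals: "finite (prefix_pals u n)"
proof -
  have "prefix_pals u n \<subseteq> (\<lambda>(i, m). factor_at u i m) ` ({..n} \<times> {..n})"
    by (auto simp: prefix_pals_def)
  then show ?thesis by (rule finite_subset) auto
qed

lemma prefix_pals_mono: "prefix_pals u n \<subseteq> prefix_pals u (Suc n)"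
  by (fastforce simp: prefix_pals_def)

lemma new_prefix_palE:
  assumes "w \<in> prefix_pals u (Suc n)" "w \<notin> prefix_pals u n"
  obtains i m where "i + m = Suc n" "w = factor_at u i m" "rev w = w"
proof -
  obtain i m where im: "i + m \<le> Suc n" "w = factor_at u i m" "rev w = w"
    using assms(1) by (auto simp: prefix_pals_def)
  moreover have "\<not> i + m \<le> n" using assms(2) im by (auto simp: prefix_pals_def)
  ultimately show ?thesis using that[of i m] by simp
qed

text \<open>A palindromic suffix of a longer palindrome is also a prefix of it, hence not new.\<close>

lemma new_prefix_pal_unique:
  assumes v: "v \<in> prefix_pals u (Suc n)" "v \<notin> prefix_pals u n"
    and w: "w \<in> prefix_pals u (Suc n)" "w \<notin> prefix_pals u n"
  shows "v = w"
proof -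
  have "l \<le> m"
    if im: "i + m = Suc n" "w = factor_at u i m" "rev w = w" "w \<notin> prefix_pals u n"
      and kl: "k + l = Suc n" "v = factor_at u k l" "rev v = v" for i m k l and v w :: "'a list"
  proof (rule ccontr)
    assume "\<not> l \<le> m"
    have "factor_at u k l = rev (factor_at u k l)" using kl by simp
    moreover have "k + (l - m) = i" using \<open>\<not> l \<le> m\<close> kl(1) im(1) by linarith
    ultimately have "factor_at u k m = rev (factor_at u i m)"
      using factor_at_rev_sub[of u k l u k 0 m] \<open>\<not> l \<le> m\<close> by simp
    then have "w = factor_at u k m" using im by simp
    moreover have "k + m \<le> n" using \<open>\<not> l \<le> m\<close> kl(1) by simp
    ultimately show False using im unfolding prefix_pals_def by blast
  qed
  note longer = this
  obtain i m where im: "i + m = Suc n" "w = factor_at u i m" "rev w = w"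
    using new_prefix_palE[OF w] .
  obtain k l where kl: "k + l = Suc n" "v = factor_at u k l" "rev v = v"
    using new_prefix_palE[OF v] .
  have "l = m" using longer[OF im w(2) kl] longer[OF kl v(2) im] by simp
  moreover from this have "k = i" using im(1) kl(1) by simp
  ultimately show ?thesis using im(2) kl(2) by simp
qed

definition lacunas :: "(nat \<Rightarrow> 'a) \<Rightarrow> nat set" where
  "lacunas u = {n. prefix_pals u (Suc n) = prefix_pals u n}"

text \<open>Each letter adds at most one palindrome, so the defect stays constant when one appears
  and otherwise grows by 1.\<close>

lemma defect_prefix_of_eq_card: "defect (prefix_of u n) = int (card (lacunas u \<inter> {..<n}))"
proof (induction n)
  case 0
  have "prefix_pals u 0 = {[]}" by (auto simp: prefix_pals_def factor_at_def)
  then show ?case by (simp add: defect_prefix_of)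
next
  case (Suc n)
  show ?case
  proof (cases "n \<in> lacunas u")
    case True
    then have "lacunas u \<inter> {..<Suc n} = insert n (lacunas u \<inter> {..<n})" by auto
    then show ?thesis using Suc True by (simp add: defect_prefix_of lacunas_def)
  next
    case False
    then obtain w where w: "w \<in> prefix_pals u (Suc n)" "w \<notin> prefix_pals u n"
      using prefix_pals_mono[of u n] by (auto simp: lacunas_def)
    then have "prefix_pals u (Suc n) = insert w (prefix_pals u n)"
      using new_prefix_pal_unique prefix_pals_mono[of u n] by blast
    moreover have "lacunas u \<inter> {..<Suc n} = lacunas u \<inter> {..<n}"
      using False by (auto simp: less_Suc_eq)
    ultimately show ?thesis
      using Suc w finite_prefix_pals[of u n] by (simp add: defect_prefix_of)
  qed
qed

lemma finite_defect_iff: "finite_defect u \<longleftrightarrow> finite (lacunas u)"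
proof
  assume "finite_defect u"
  then obtain B where B: "\<And>n. int (card (lacunas u \<inter> {..<n})) \<le> B"
    unfolding finite_defect_def defect_prefix_of_eq_card by blast
  show "finite (lacunas u)"
  proof (rule ccontr)
    assume "infinite (lacunas u)"
    then obtain A where A: "A \<subseteq> lacunas u" "finite A" "card A = Suc (nat B)"
      using infinite_arbitrarily_large by blast
    then obtain n where "A \<subseteq> {..<n}" using finite_nat_set_iff_bounded[of A] by (metis lessThan_iff subsetI)
    with A have "card A \<le> card (lacunas u \<inter> {..<n})" by (intro card_mono) auto
    with B[of n] A(3) show False by linarith
  qed
next
  assume "finite (lacunas u)"
  then have "card (lacunas u \<inter> {..<n}) \<le> card (lacunas u)" for n by (intro card_mono) auto
  then show "finite_defect u"
    unfolding finite_defect_def defect_prefix_of_eq_card by (meson of_nat_mono)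
qed

text \<open>
  Beyond \<open>N\<close>, a position without a new palindrome is one where a reversal class of length \<open>N\<close> ends
  for the first time, since otherwise the longest palindromic suffix could be extended.
\<close>

lemma finite_lacunas_if_palindromic_returns:
  fixes u :: "nat \<Rightarrow> 'a::finite"
  assumes ret: "\<And>n. n \<ge> N \<Longrightarrow> palindromic_returns u n"
  shows "finite (lacunas u)"
proof -
  let ?c = "factor_class u N"
  let ?X = "lacunas u \<inter> {N..}"
  have extend: "\<exists>i<s. rev (factor_at u i (s - i + n)) = factor_at u i (s - i + n)"
    if "n \<ge> N" "s' < s" "factor_class u n s' = factor_class u n s" for n s s'
    using first_return_exists[OF that(3,2)] ret[OF that(1)]
    unfolding palindromic_returns_def first_return_def by metis
  have fresh: "?c s' \<noteq> ?c (Suc k - N)" if k: "k \<in> ?X" and s': "s' < Suc k - N" for k s'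
  proof
    assume eq: "?c s' = ?c (Suc k - N)"
    let ?P = "\<lambda>i. rev (factor_at u i (Suc k - i)) = factor_at u i (Suc k - i)"
    \<comment> \<open>Start of the longest palindromic suffix of the prefix of length
      \<open>Suc k\<close>; the empty suffix guarantees that one exists.\<close>
    define i where "i = (LEAST i. ?P i)"
    have P: "?P (Suc k)" by (simp add: factor_at_def)
    have Pi: "?P i" unfolding i_def using P by (rule LeastI)
    have ik: "i \<le> Suc k" unfolding i_def using P by (rule Least_le)
    have least: "i \<le> i'" if "?P i'" for i' unfolding i_def by (rule Least_le) (rule that)
    define m where "m = Suc k - i"
    have im: "i + m = Suc k" using ik by (simp add: m_def)
    have pal: "rev (factor_at u i m) = factor_at u i m" using Pi by (simp add: m_def)
    have "factor_at u i m \<in> prefix_pals u (Suc k)" using pal im unfolding prefix_pals_def by fastforce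
    with k have "factor_at u i m \<in> prefix_pals u k" by (simp add: lacunas_def)
    then obtain i' m' where i': "factor_at u i m = factor_at u i' m'" "i' + m' \<le> k"
      by (auto simp: prefix_pals_def)
    have "m' = m" using arg_cong[OF i'(1), of length] by simp
    show False
    proof (cases "m \<ge> N")
      \<comment> \<open>The suffix occurred before, so a return to its own class extends it to the
        left.\<close>
      case True
      have "i' < i" using i'(2) \<open>m' = m\<close> im by simp
      moreover have "factor_class u m i' = factor_class u m i"
        using i'(1) \<open>m' = m\<close> by (simp add: factor_class_def)
      ultimately obtain b where b: "b < i"
        "rev (factor_at u b (i - b + m)) = factor_at u b (i - b + m)"
        using extend[OF True] by blast
      have "i - b + m = Suc k - b" using im b by simp
      with b least[of b] show False by simp
    next
      \<comment> \<open>The repeated window of length \<open>N\<close> yields a palindromic suffix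
        longer than \<open>N\<close>, against maximality.\<close>
      case False
      obtain b where b: "b < Suc k - N"
        "rev (factor_at u b (Suc k - N - b + N)) = factor_at u b (Suc k - N - b + N)"
        using extend[OF order.refl s' eq] by blast
      have "Suc k - N - b + N = Suc k - b" using b by simp
      with b(2) least[of b] have "i \<le> b" by simp
      with b(1) False im show False by simp
    qed
  qed
  \<comment> \<open>Elements of \<open>?X\<close> thus give distinct classes, and a finite alphabet
    has only finitely many.\<close>
  have "inj_on (\<lambda>k. ?c (Suc k - N)) ?X"
  proof (rule linorder_inj_onI)
    fix k l assume "k < l" "k \<in> ?X" "l \<in> ?X"
    then show "?c (Suc k - N) \<noteq> ?c (Suc l - N)" by (intro fresh) auto
  qed auto
  moreover have "(\<lambda>k. ?c (Suc k - N)) ` ?X \<subseteq> range ?c" by auto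
  moreover have "finite (range ?c)" unfolding range_factor_class by (intro finite_imageI finite_lang_n)
  ultimately have "finite ?X" by (meson finite_imageD finite_subset)
  moreover have "lacunas u \<subseteq> ?X \<union> {..<N}" by auto
  ultimately show ?thesis by (meson finite_UnI finite_lessThan finite_subset)
qed

text \<open>
  It suffices to look at the first occurrence of the class of the spanned factor: there the new
  palindrome ending with it can neither be longer nor shorter than this factor.
\<close>

lemma palindromic_returns_if_no_lacunas:
  assumes new: "\<And>k. k \<ge> n \<Longrightarrow> k \<notin> lacunas u"
  shows "palindromic_returns u n"
  unfolding palindromic_returns_def
proof (intro allI impI)
  fix i j assume fr: "first_return (factor_class u n) i j"
  then have ij: "i < j" and cij: "factor_class u n i = factor_class u n j"
    and no: "\<And>k. i < k \<Longrightarrow> k < j \<Longrightarrow> factor_class u n k \<noteq> factor_class u n i"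
    by (auto simp: first_return_def)
  define d where "d = j - i"
  define l where "l = d + n"
  have d: "0 < d" "j = i + d" using ij by (auto simp: d_def)
  define a where "a = (LEAST a. factor_class u l a = factor_class u l i)"
  have a: "factor_class u l a = factor_class u l i" unfolding a_def by (rule LeastI) simp
  have a_le: "a \<le> b" if "factor_class u l b = factor_class u l a" for b
    unfolding a_def by (rule Least_le) (use that a in simp)
  \<comment> \<open>The return structure at \<open>i\<close> carries over to \<open>a\<close>, with
    offset \<open>x\<close> replaced by \<open>d - x\<close> if the word is reversed.\<close>
  have ends: "factor_class u n a = factor_class u n (a + d)"
    and inner: "\<And>x. 0 < x \<Longrightarrow> x < d \<Longrightarrow> factor_class u n (a + x) \<noteq> factor_class u n a"
  proof -
    from a have "factor_class u n a = factor_class u n (a + d) \<and>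
      (\<forall>x. 0 < x \<longrightarrow> x < d \<longrightarrow> factor_class u n (a + x) \<noteq> factor_class u n a)"
    proof (cases rule: factor_class_cases)
      case 1
      have eq: "factor_class u n (a + x) = factor_class u n (i + x)" if "x \<le> d" for x
        using factor_class_eq_sub[OF 1, of x n] that by (simp add: l_def)
      show ?thesis using eq[of 0] eq[of d] eq no cij d by auto
    next
      case 2
      have eq: "factor_class u n (a + x) = factor_class u n (i + (d - x))" if "x \<le> d" for x
        using factor_class_rev_sub[OF 2, of x n] that by (simp add: l_def)
      show ?thesis using eq[of 0] eq[of d] eq no cij d by auto
    qed
    then show "factor_class u n a = factor_class u n (a + d)"
      "\<And>x. 0 < x \<Longrightarrow> x < d \<Longrightarrow> factor_class u n (a + x) \<noteq> factor_class u n a" by blast+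
  qed
  define k where "k = a + l - 1"
  have k: "Suc k = a + l" "a + n \<le> k" using d by (auto simp: k_def l_def)
  then have "k \<notin> lacunas u" using new by simp
  then obtain w where w: "w \<in> prefix_pals u (Suc k)" "w \<notin> prefix_pals u k"
    using prefix_pals_mono[of u k] by (auto simp: lacunas_def)
  obtain b m where bm: "b + m = Suc k" "w = factor_at u b m" "rev w = w"
    using new_prefix_palE[OF w] .
  have old: False if "factor_at u x m = w" "x + m \<le> k" for x
    using w(2) that bm(3) unfolding prefix_pals_def by blast
  have refl: "factor_at u b m = rev (factor_at u b m)" using bm by simp
  consider "b < a" | "b = a" | "a < b" "b \<le> a + d" | "a + d < b" by linarith
  then have "b = a"
  proof cases
    \<comment> \<open>\<open>w\<close> contains the spanned factor as a suffix, so its mirror image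
      starts at \<open>b\<close>, before the first occurrence.\<close>
    case 1
    then have "b + (m - l) = a" "l \<le> m" using bm(1) k(1) by auto
    with factor_class_rev_sub[OF refl, of 0 l] have "factor_class u l b = factor_class u l a"
      by simp
    with a_le[of b] 1 show ?thesis by simp
  next
    \<comment> \<open>The last window, mirrored in \<open>w\<close>, starts at \<open>b\<close>;
      this forces \<open>b = a + d\<close>, and then \<open>w\<close> already occurred at
      \<open>a\<close>.\<close>
    case 3
    then have "b + (m - n) = a + d" "n \<le> m" using bm(1) k(1) by (auto simp: l_def)
    with factor_class_rev_sub[OF refl, of 0 n] ends
    have cb: "factor_class u n b = factor_class u n a" by simp
    with inner[of "b - a"] 3 have "b = a + d" by force
    then have "m = n" using bm(1) k(1) by (simp add: l_def)
    from cb have "factor_at u a n = factor_at u b n"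
      by (cases rule: factor_class_cases) (use refl \<open>m = n\<close> in auto)
    then show ?thesis using old[of a] \<open>m = n\<close> bm(2) k(2) by simp
  next
    \<comment> \<open>\<open>w\<close> lies inside the last window, so it already occurred in the
      window at \<open>a\<close>.\<close>
    case 4
    then have m: "m \<le> n" "b = a + d + (n - m)" using bm(1) k(1) by (auto simp: l_def)
    from ends show ?thesis
    proof (cases rule: factor_class_cases)
      case 1
      from factor_at_eq_sub[OF this, of "n - m" m] m bm(2) k(2) old[of "a + (n - m)"]
      show ?thesis by simp
    next
      case 2
      from factor_at_rev_sub[OF this, of 0 m] m bm k(2) old[of a]
      show ?thesis by simp
    qed
  qed
  then have "m = l" using bm(1) k(1) by simp
  then have "rev (factor_at u a l) = factor_at u a l" using bm \<open>b = a\<close> by simp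
  then show "rev (factor_at u i (j - i + n)) = factor_at u i (j - i + n)"
    using factor_class_eq_palindrome[OF a] by (simp add: l_def d_def)
qed

section \<open>Summability of integer sequences and the equivalence\<close>

lemma summable_of_int_iff:
  fixes f :: "nat \<Rightarrow> int"
  shows "summable (\<lambda>n. real_of_int (f n)) \<longleftrightarrow> (\<exists>N. \<forall>n\<ge>N. f n = 0)"
proof
  assume "summable (\<lambda>n. real_of_int (f n))"
  then have "(\<lambda>n. real_of_int (f n)) \<longlonglongrightarrow> 0" by (rule summable_LIMSEQ_zero)
  \<comment> \<open>An integer of absolute value below 1 is 0.\<close>
  then obtain N where "\<forall>n\<ge>N. norm (real_of_int (f n) - 0) < 1"
    using LIMSEQ_D zero_less_one by blast
  then show "\<exists>N. \<forall>n\<ge>N. f n = 0" by (intro exI[of _ N]) auto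
next
  assume "\<exists>N. \<forall>n\<ge>N. f n = 0"
  then obtain N where "\<forall>n\<ge>N. f n = 0" by blast
  then show "summable (\<lambda>n. real_of_int (f n))"
    by (intro summable_finite[of "{..<N}"]) auto
qed

theorem theorem2:
  fixes u :: "nat \<Rightarrow> 'a::finite"
  assumes "closed_under_reversal u"
  shows "finite_defect u \<longleftrightarrow> summable (\<lambda>n. real_of_int (T_fun u n))"
  unfolding finite_defect_iff summable_of_int_iff
proof
  assume "finite (lacunas u)"
  then obtain N where "\<And>k. k \<ge> N \<Longrightarrow> k \<notin> lacunas u"
    by (metis finite_nat_set_iff_bounded not_le)
  then have "T_fun u n = 0" if "n \<ge> N" for n
    using that
    by (intro T_fun_eq_0_if_palindromic_returns[OF assms] palindromic_returns_if_no_lacunas) auto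
  then show "\<exists>N. \<forall>n\<ge>N. T_fun u n = 0" by blast
next
  assume "\<exists>N. \<forall>n\<ge>N. T_fun u n = 0"
  then obtain N where "\<And>n. n \<ge> N \<Longrightarrow> T_fun u n = 0" by blast
  then show "finite (lacunas u)"
    by (intro finite_lacunas_if_palindromic_returns[of N] palindromic_returns_if_T_fun_eq_0[OF assms])
qed

end
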